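(* Let $k$ be a non-negative integer, let $n = 2k+1$, and let $M_n$ be the adjacency matrix of the middle-cube graph. For every integer $r$ with $1 \le r \le k$, $$E_{k+1-r} = V_{k,k+1}^{(r)}$$ and $$\dim E_{k+1-r} = \dim E_{r-k-1} = \binom{n}{r} - \binom{n}{r-1}.$$ Furthermore, the characteristic polynomial of $M_n$ is $$\det(\lambda I - M_n) = \prod_{i=1}^{k+1} \big((\lambda - i)(\lambda + i)\big)^{\binom{n}{k+1-i} - \binom{n}{k-i}}.$$ Here $E_\lambda$ and $V_{k,k+1}^{(r)}$ are the real vector spaces defined in the context.
   Context: Let $S = \{1,2,\dots,n\}$ with $n = 2k+1$, and let $\binom{A}{m}$ denote the set of all $m$-element subsets of a set $A$. The middle-cube $M_n$ is the graph with vertex set $\binom{S}{k} \cup \binom{S}{k+1}$ in which two distinct vertices $A, B$ are adjacent if and only if $A \subset B$ or $B \subset A$; the same symbol $M_n$ denotes its adjacency matrix. For each $i$ fix an ordering $A_1^{(i)}, \dots, A_{\binom{n}{i}}^{(i)}$ of the $i$-subsets of $S$; the rows and columns of $M_n$ are indexed by $A_1^{(k)}, \dots, A_{\binom{n}{k}}^{(k)}, A_1^{(k+1)}, \dots, A_{\binom{n}{k+1}}^{(k+1)}$ in this order. $E_\lambda$ is the (real) eigenspace of $M_n$ for the value $\lambda$, i.e. the kernel of $M_n - \lambda I$. Fix $r$ with $1 \le r \le k$. A weight function is a real-valued function $f$ on $\binom{S}{r}$ such that $$\sum_{i \in S \setminus R} f(R \cup \{i\}) = 0 \quad \text{for each }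 R \in \binom{S}{r-1}.$$ It is extended to all subsets $A \subseteq S$ by $f(A) = \sum_{B \in \binom{A}{r}} f(B)$ (so $f(A)=0$ if $|A| \le r-1$). Define $$V_{k,k+1}^{(r)} = \left\{ \left( f(A_1^{(k)}), \dots, f(A_{\binom{n}{k}}^{(k)}), f(A_1^{(k+1)}), \dots, f(A_{\binom{n}{k+1}}^{(k+1)}) \right) : f \text{ a weight function} \right\},$$ a real vector space. Convention: $\binom{n}{-1} = 0$. *)

theory Defs
  imports
    "Jordan_Normal_Form.Matrix_Kernel"
    "Jordan_Normal_Form.Char_Poly"
    "HOL-Library.Ramsey"
begin

definition ground :: "nat \<Rightarrow> nat set" where
  "ground k = {1..2 * k + 1}"

definition middle_cube_verts :: "nat \<Rightarrow> nat set set" where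
  "middle_cube_verts k = nsets (ground k) k \<union> nsets (ground k) (k + 1)"

definition middle_cube_adj :: "nat \<Rightarrow> nat set \<Rightarrow> nat set \<Rightarrow> bool" where
  "middle_cube_adj k A B \<longleftrightarrow>
     A \<in> middle_cube_verts k \<and> B \<in> middle_cube_verts k \<and> A \<noteq> B \<and> (A \<subset> B \<or> B \<subset> A)"

definition adjacency_matrix :: "('v \<Rightarrow> 'v \<Rightarrow> bool) \<Rightarrow> 'v list \<Rightarrow> real mat" where
  "adjacency_matrix adj vs =
     mat (length vs) (length vs) (\<lambda>(i, j). if adj (vs ! i) (vs ! j) then 1 else 0)"

text \<open>
  A family \<open>As\<close> of lists fixes, for each \<open>i\<close>, an ordering of the \<open>i\<close>-subsets of the ground set.
\<close>

definition subset_orderings :: "nat \<Rightarrow> (nat \<Rightarrow> nat set list) \<Rightarrow> bool" where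
  "subset_orderings k As \<longleftrightarrow> (\<forall>i. distinct (As i) \<and> set (As i) = nsets (ground k) i)"

definition middle_cube_matrix :: "nat \<Rightarrow> (nat \<Rightarrow> nat set list) \<Rightarrow> real mat" where
  "middle_cube_matrix k As = adjacency_matrix (middle_cube_adj k) (As k @ As (k + 1))"

text \<open>
  \<open>char_matrix M l\<close> is \<open>M - l I\<close>; its \<open>kernel_dim\<close> is the dimension of the eigenspace below.
\<close>

definition eigenspace :: "real mat \<Rightarrow> real \<Rightarrow> real vec set" where
  "eigenspace M l = mat_kernel (char_matrix M l)"

definition eigenspace_dim :: "real mat \<Rightarrow> real \<Rightarrow> nat" where
  "eigenspace_dim M l = kernel_dim (char_matrix M l)"

text \<open>
  A weight function is represented by a total function on sets; its values off the \<open>r\<close>-subsets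
  of the ground set enter neither the condition nor the extension. It is used for \<open>r \<ge> 1\<close> only.
\<close>

definition weight_function :: "nat \<Rightarrow> nat \<Rightarrow> (nat set \<Rightarrow> real) \<Rightarrow> bool" where
  "weight_function k r f \<longleftrightarrow>
     (\<forall>R \<in> nsets (ground k) (r - 1). (\<Sum>i \<in> ground k - R. f (R \<union> {i})) = 0)"

definition weight_ext :: "nat \<Rightarrow> (nat set \<Rightarrow> real) \<Rightarrow> nat set \<Rightarrow> real" where
  "weight_ext r f A = (\<Sum>B \<in> nsets A r. f B)"

definition weight_space :: "nat \<Rightarrow> (nat \<Rightarrow> nat set list) \<Rightarrow> nat \<Rightarrow> real vec set" where
  "weight_space k As r =
     {vec_of_list (map (weight_ext r f) (As k @ As (k + 1))) | f. weight_function k r f}"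

text \<open>Binomial coefficient with the convention that it is zero for negative lower index.\<close>

definition binom :: "nat \<Rightarrow> int \<Rightarrow> int" where
  "binom n j = (if j < 0 then 0 else int (n choose nat j))"

end

(*
For a weight function f on r-subsets, counting pairs gives
  sum_{i not in A} f(A + i) = (n - |A| - r) f(A)   and   sum_{i in A} f(A - i) = (|A| - r) f(A),
so on the middle layers f is an eigenvector for k + 1 - r, and it becomes one for r - k - 1 after a
sign change on the k-subsets.  As n - j - r > 0 for j < k and r <= k, the first identity lets a zero
extension on the k-subsets descend to the r-subsets, so the extension map is injective.  The weight
functions solve (n choose (r-1)) linear equations in (n choose r) unknowns, hence contain
(n choose r) - (n choose (r-1)) independent ones.  Summed over 0 <= r <= k and both signs these
lower bounds telescope to 2 (n choose k), the order of the matrix, so the eigenvectors found form a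
basis and every bound is attained.
*)

theory Submission
  imports Defs "Jordan_Normal_Form.Jordan_Normal_Form_Uniqueness"
begin

section \<open>Bases of eigenvectors\<close>

text \<open>Equations are added one at a time, and each costs one solution: a pivot solution
  corrects the others and is then dropped. Exactly \<open>card Y - card X\<close> solutions are kept
  even when the equations are dependent. The indices \<open>J\<close> are mere labels, inherited
  from the unit vectors of the case without equations.\<close>

lemma ex_independent_solutions:
  fixes a :: "'x \<Rightarrow> 'y \<Rightarrow> 'a::field"
  assumes "finite X" "finite Y" "card X \<le> card Y"
  shows "\<exists>J w. J \<subseteq> Y \<and> card J + card X = card Y \<and>
           (\<forall>j\<in>J. \<forall>x\<in>X. (\<Sum>y\<in>Y. a x y * w j y) = 0) \<and>
           (\<forall>c. (\<forall>y\<in>Y. (\<Sum>j\<in>J. c j * w j y) = 0) \<longrightarrow> (\<forall>j\<in>J. c j = 0))"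
  using assms(1,3)
proof (induction X rule: finite_induct)
  case empty
  have "(\<Sum>j\<in>Y. c j * (if j = y then 1 else 0)) = c y" if "y \<in> Y" for c :: "'y \<Rightarrow> 'a" and y
    using that assms(2) by (simp add: sum.delta if_distrib cong: if_cong)
  then show ?case
    by (intro exI[of _ Y] exI[of _ "\<lambda>j y. if j = y then 1 else 0"]) auto
next
  case (insert x X)
  then have "card X \<le> card Y" by simp
  from insert.IH[OF this] obtain J w where J: "J \<subseteq> Y" "card J + card X = card Y"
    and sol: "\<forall>j\<in>J. \<forall>x\<in>X. (\<Sum>y\<in>Y. a x y * w j y) = 0"
    and ind: "\<forall>c. (\<forall>y\<in>Y. (\<Sum>j\<in>J. c j * w j y) = 0) \<longrightarrow> (\<forall>j\<in>J. c j = 0)"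
    by (elim exE conjE) iprover
  have "finite J" using J(1) assms(2) finite_subset by blast
  define t where "t j = (\<Sum>y\<in>Y. a x y * w j y)" for j
  have "card J \<noteq> 0" using J(2) insert.prems insert.hyps by simp
  then have "J \<noteq> {}" by auto
  \<comment> \<open>The pivot is a solution that violates the new equation. If none does, any
    \<open>p\<close> may be dropped: then every \<open>t j\<close> is 0, and so is every quotient
    \<open>q j\<close>.\<close>
  then obtain p where p: "p \<in> J" "t p \<noteq> 0 \<or> (\<forall>j\<in>J. t j = 0)" by blast
  define q where "q j = t j / t p" for j
  define w' where "w' j y = w j y - q j * w p y" for j y
  have lin: "(\<Sum>y\<in>Y. b y * w' j y) = (\<Sum>y\<in>Y. b y * w j y) - q j * (\<Sum>y\<in>Y. b y * w p y)" for b j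
    by (simp add: w'_def right_diff_distrib sum_subtractf sum_distrib_left mult.left_commute)
  have "t j - q j * t p = 0" if "j \<in> J" for j
    using p that by (auto simp: q_def)
  then have sol': "(\<Sum>y\<in>Y. a z y * w' j y) = 0" if "j \<in> J - {p}" "z \<in> insert x X" for j z
  proof (cases "z = x")
    case True
    then show ?thesis using that(1) \<open>\<And>j. j \<in> J \<Longrightarrow> t j - q j * t p = 0\<close>[of j]
      unfolding lin t_def by blast
  next
    case False
    then show ?thesis using that sol p(1) by (simp add: lin)
  qed
  have ind': "\<forall>j\<in>J - {p}. c j = 0"
    if c: "\<And>y. y \<in> Y \<Longrightarrow> (\<Sum>j\<in>J - {p}. c j * w' j y) = 0" for c
  proof -
    \<comment> \<open>Expanding \<open>w'\<close> turns a combination of the corrected solutions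
      into one of the old solutions, in which the pivot collects all the corrections; independence
      of \<open>w\<close> then applies.\<close>
    define c' where "c' j = (if j = p then - (\<Sum>j\<in>J - {p}. c j * q j) else c j)" for j
    have eq: "(\<Sum>j\<in>J. c' j * w j y) = (\<Sum>j\<in>J - {p}. c j * w' j y)" for y
    proof -
      have "(\<Sum>j\<in>J. c' j * w j y) = c' p * w p y + (\<Sum>j\<in>J - {p}. c' j * w j y)"
        using \<open>finite J\<close> p(1) by (rule sum.remove)
      also have "(\<Sum>j\<in>J - {p}. c' j * w j y) = (\<Sum>j\<in>J - {p}. c j * w j y)"
        by (rule sum.cong) (auto simp: c'_def)
      also have "c' p * w p y = - (\<Sum>j\<in>J - {p}. c j * q j * w p y)"
        by (simp add: c'_def sum_distrib_right)
      finally show ?thesis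
        by (simp add: w'_def right_diff_distrib sum_subtractf mult.assoc)
    qed
    have c'0: "c' j = 0" if "j \<in> J" for j using that by (rule ind[rule_format, rotated]) (simp only: eq c)
    show ?thesis
    proof
      fix j assume "j \<in> J - {p}"
      then show "c j = 0" using c'0[of j] by (simp add: c'_def)
    qed
  qed
  have "card (J - {p}) + card (insert x X) = card Y"
    using J(2) insert.hyps card_Suc_Diff1[OF \<open>finite J\<close> p(1)] by simp
  moreover have "J - {p} \<subseteq> Y" using J(1) by blast
  moreover have "\<forall>j\<in>J - {p}. \<forall>z\<in>insert x X. (\<Sum>y\<in>Y. a z y * w' j y) = 0"
    by (intro ballI sol')
  moreover have "\<forall>c. (\<forall>y\<in>Y. (\<Sum>j\<in>J - {p}. c j * w' j y) = 0) \<longrightarrow> (\<forall>j\<in>J - {p}. c j = 0)"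
    by (intro allI impI ind') (simp only:)
  ultimately show ?case
    by (intro exI conjI)
qed

text \<open>Eigenvectors for different eigenvalues cannot cancel one another, so independence has to
  be checked only within each eigenvalue, which is what \<open>indep\<close> states.\<close>

lemma eigenvectors_independent:
  fixes A :: "'a::field mat"
  assumes A: "A \<in> carrier_mat N N" and I: "finite I"
    and e: "\<And>x. x \<in> I \<Longrightarrow> e x \<in> carrier_vec N"
    and eigen: "\<And>x. x \<in> I \<Longrightarrow> A *\<^sub>v e x = d x \<cdot>\<^sub>v e x"
    and indep: "\<And>\<mu> c. (\<And>i. i < N \<Longrightarrow> (\<Sum>x | x \<in> I \<and> d x = \<mu>. c x * e x $ i) = 0)
                  \<Longrightarrow> \<forall>x\<in>I. d x = \<mu> \<longrightarrow> c x = 0"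
    and zero: "\<And>i. i < N \<Longrightarrow> (\<Sum>x\<in>I. c x * e x $ i) = 0"
    and y: "y \<in> I"
  shows "c y = 0"
proof -
  have eq: "(\<Sum>j<N. A $$ (i, j) * e x $ j) = d x * e x $ i" if "x \<in> I" "i < N" for x i
  proof -
    have "(A *\<^sub>v e x) $ i = (d x \<cdot>\<^sub>v e x) $ i" using eigen[OF that(1)] by simp
    then show ?thesis using A e[OF that(1)] that(2)
      by (simp add: scalar_prod_def lessThan_atLeast0)
  qed
  \<comment> \<open>Applying a polynomial in \<open>A\<close> to a vanishing combination multiplies its coefficients by the
    values \<open>poly p (d x)\<close>; a Lagrange polynomial then isolates one eigenvalue.\<close>
  have poly_zero: "(\<Sum>x\<in>I. c x * poly p (d x) * e x $ i) = 0" if "i < N" for p i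
    using that
  proof (induction p arbitrary: i)
    case (pCons a p)
    have "(\<Sum>x\<in>I. c x * poly (pCons a p) (d x) * e x $ i)
        = a * (\<Sum>x\<in>I. c x * e x $ i) + (\<Sum>x\<in>I. c x * poly p (d x) * (d x * e x $ i))"
      unfolding sum_distrib_left sum.distrib[symmetric]
      by (intro sum.cong) (auto simp: algebra_simps)
    also have "(\<Sum>x\<in>I. c x * poly p (d x) * (d x * e x $ i))
        = (\<Sum>x\<in>I. c x * poly p (d x) * (\<Sum>j<N. A $$ (i, j) * e x $ j))"
      using pCons.prems by (intro sum.cong) (auto simp: eq)
    also have "\<dots> = (\<Sum>x\<in>I. \<Sum>j<N. A $$ (i, j) * (c x * poly p (d x) * e x $ j))"
      by (simp add: sum_distrib_left mult_ac)
    also have "\<dots> = (\<Sum>j<N. A $$ (i, j) * (\<Sum>x\<in>I. c x * poly p (d x) * e x $ j))"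
      by (subst sum.swap) (simp add: sum_distrib_left)
    finally show ?case using pCons zero by simp
  qed simp
  define p where "p = (\<Prod>\<nu>\<in>d ` I - {d y}. [:- \<nu>, 1:])"
  have p: "poly p \<nu> = (\<Prod>\<nu>'\<in>d ` I - {d y}. \<nu> - \<nu>')" for \<nu>
    by (simp add: p_def poly_prod)
  have p0: "poly p (d x) = 0" if "x \<in> I" "d x \<noteq> d y" for x
    using that I by (auto simp: p)
  have "(\<Sum>x | x \<in> I \<and> d x = d y. c x * poly p (d x) * e x $ i) = 0" if "i < N" for i
  proof -
    have "(\<Sum>x | x \<in> I \<and> d x = d y. c x * poly p (d x) * e x $ i) =
          (\<Sum>x\<in>I. c x * poly p (d x) * e x $ i)"
      using I by (intro sum.mono_neutral_left) (auto simp: p0)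
    then show ?thesis using poly_zero[OF that] by simp
  qed
  then have "c y * poly p (d y) = 0"
    using indep[where \<mu> = "d y" and c = "\<lambda>x. c x * poly p (d x)"] y by blast
  moreover have "poly p (d y) \<noteq> 0" using I by (auto simp: p)
  ultimately show ?thesis by simp
qed

text \<open>Makes a diagonal matrix a Jordan normal form with blocks of size one, so that
  characteristic polynomial and kernel dimension can be read off from the theory of Jordan
  forms.\<close>

lemma jordan_matrix_diagonal:
  "jordan_matrix (map (Pair 1) ds) = mat_diag (length ds) ((!) ds)"
proof (induction ds)
  case Nil
  show ?case by (intro eq_matI) (auto simp: jordan_matrix_def mat_diag_def)
next
  case (Cons a ds)
  have "jordan_matrix (map (Pair 1) (a # ds)) =
    four_block_mat (jordan_block 1 a) (0\<^sub>m 1 (length ds)) (0\<^sub>m (length ds) 1)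
      (jordan_matrix (map (Pair 1) ds))"
    using jordan_matrix_dim[of "map (Pair 1) ds"]
    by (simp add: jordan_matrix_def Let_def comp_def sum_list_triv)
  also have "\<dots> = mat_diag (length (a # ds)) ((!) (a # ds))"
    unfolding Cons.IH
    by (intro eq_matI) (auto simp: mat_diag_def jordan_block_def nth_Cons split: nat.split)
  finally show ?case .
qed

lemma char_matrix_mult_vec:
  fixes A :: "'a::field mat"
  assumes A: "A \<in> carrier_mat N N" and v: "v \<in> carrier_vec N"
  shows "char_matrix A \<mu> *\<^sub>v v = A *\<^sub>v v + (- \<mu>) \<cdot>\<^sub>v v"
proof -
  have "((- \<mu>) \<cdot>\<^sub>m 1\<^sub>m N) *\<^sub>v v = (- \<mu>) \<cdot>\<^sub>v v"
    using v by (intro eq_vecI) auto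
  then show ?thesis
    using A v unfolding char_matrix_def
    by (subst add_mult_distrib_mat_vec[of _ N N]) auto
qed

lemma mat_kernel_char_matrixI:
  fixes A :: "'a::field mat"
  assumes A: "A \<in> carrier_mat N N" and v: "v \<in> carrier_vec N"
    and eigen: "A *\<^sub>v v = \<mu> \<cdot>\<^sub>v v"
  shows "v \<in> mat_kernel (char_matrix A \<mu>)"
proof (rule mat_kernelI[OF char_matrix_closed[OF A] v])
  show "char_matrix A \<mu> *\<^sub>v v = 0\<^sub>v N"
    unfolding char_matrix_mult_vec[OF A v] eigen using v by (intro eq_vecI) auto
qed

text \<open>With as many independent eigenvectors as rows, the matrix \<open>P\<close> having them
  as columns is invertible and diagonalizes \<open>A\<close>. Hence \<open>card I = N\<close> turns
  lower bounds for the eigenspaces into exact dimensions.\<close>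

lemma eigenvector_basis:
  fixes A :: "'a::field mat"
  assumes A: "A \<in> carrier_mat N N" and I: "finite I" "card I = N"
    and e: "\<And>x. x \<in> I \<Longrightarrow> e x \<in> carrier_vec N"
    and eigen: "\<And>x. x \<in> I \<Longrightarrow> A *\<^sub>v e x = d x \<cdot>\<^sub>v e x"
    and indep: "\<And>\<mu> c. (\<And>i. i < N \<Longrightarrow> (\<Sum>x | x \<in> I \<and> d x = \<mu>. c x * e x $ i) = 0)
                  \<Longrightarrow> \<forall>x\<in>I. d x = \<mu> \<longrightarrow> c x = 0"
  shows "char_poly A = (\<Prod>x\<in>I. [:- d x, 1:])"
    and "kernel_dim (char_matrix A \<mu>) = card {x \<in> I. d x = \<mu>}"
    and "v \<in> mat_kernel (char_matrix A \<mu>) \<Longrightarrow>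
           \<exists>c. \<forall>i<N. v $ i = (\<Sum>x | x \<in> I \<and> d x = \<mu>. c x * e x $ i)"
proof -
  note eig_indep = eigenvectors_independent[OF A I(1) e eigen indep]
  \<comment> \<open>Columns are numbered while eigenvectors are labelled by \<open>I\<close>;
    \<open>h\<close> numbers the labels and \<open>g\<close> inverts it.\<close>
  obtain h where h: "bij_betw h {0..<N} I"
    using ex_bij_betw_nat_finite[OF I(1)] I(2) by auto
  then have h_mem: "\<And>j. j < N \<Longrightarrow> h j \<in> I" and h_inj: "inj_on h {0..<N}"
    by (auto simp: bij_betw_def)
  define g where "g = inv_into {0..<N} h"
  have g: "g (h j) = j" if "j < N" for j
    using that h_inj by (auto simp: g_def)
  have hg: "h (g x) = x" "g x < N" if "x \<in> I" for x
    using that h bij_betw_inv_into_right[OF h that] bij_betwE[OF bij_betw_inv_into[OF h]]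
    by (auto simp: g_def)
  have reindex: "(\<Sum>j = 0..<N. F (h j)) = sum F I" for F :: "_ \<Rightarrow> 'a"
    by (rule sum.reindex_bij_betw[OF h])
  define P where "P = mat N N (\<lambda>(i, j). e (h j) $ i)"
  define D where "D = mat_diag N (d \<circ> h)"
  have P: "P \<in> carrier_mat N N" by (simp add: P_def)
  have D: "D \<in> carrier_mat N N" by (simp add: D_def)
  have Pv: "(P *\<^sub>v u) $ i = (\<Sum>x\<in>I. u $ (g x) * e x $ i)" if "i < N" "u \<in> carrier_vec N" for u i
  proof -
    have "(P *\<^sub>v u) $ i = (\<Sum>j = 0..<N. u $ (g (h j)) * e (h j) $ i)"
      using that P by (auto simp: P_def scalar_prod_def g mult.commute intro!: sum.cong)
    then show ?thesis by (simp add: reindex[of "\<lambda>x. u $ (g x) * e x $ i"])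
  qed
  have "det P \<noteq> 0"
  proof
    assume "det P = 0"
    then obtain u where u: "u \<in> carrier_vec N" "u \<noteq> 0\<^sub>v N" "P *\<^sub>v u = 0\<^sub>v N"
      using det_0_iff_vec_prod_zero_field[OF P] by auto
    have "u $ (g x) = 0" if "x \<in> I" for x
      using Pv[OF _ u(1)] u(3) by (intro eig_indep[of "\<lambda>x. u $ (g x)"]) (use that in auto)
    then have "u $ j = 0" if "j < N" for j
      using g[OF that] h_mem[OF that] by metis
    then have "u = 0\<^sub>v N" using u(1) by (intro eq_vecI) auto
    then show False using u(2) by simp
  qed
  then obtain Q where Q: "Q \<in> carrier_mat N N" "P * Q = 1\<^sub>m N" "Q * P = 1\<^sub>m N"
    using det_non_zero_imp_unit[OF P, of "()"] by (auto simp: Units_def ring_mat_def)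
  have AP: "A * P = P * D"
  proof (rule eq_matI)
    fix i j assume "i < dim_row (P * D)" "j < dim_col (P * D)"
    then have ij: "i < N" "j < N" using P D by auto
    have "col P j = e (h j)" using e[OF h_mem[OF ij(2)]] ij by (auto simp: P_def)
    then have "(A * P) $$ (i, j) = (A *\<^sub>v e (h j)) $ i" using A P ij by simp
    also have "\<dots> = d (h j) * e (h j) $ i"
      using eigen[OF h_mem[OF ij(2)]] e[OF h_mem[OF ij(2)]] ij by simp
    also have "\<dots> = (P * D) $$ (i, j)"
      unfolding D_def mat_diag_mult_right[OF P] using ij by (simp add: P_def)
    finally show "(A * P) $$ (i, j) = (P * D) $$ (i, j)" .
  qed (use A P D in auto)
  have "A = A * (P * Q)" using A Q by simp
  also have "\<dots> = P * D * Q" using A P Q AP by (metis assoc_mult_mat)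
  finally have "similar_mat A D"
    unfolding similar_mat_def
    using similar_mat_witI[OF Q(2,3) _ A D P Q(1)] by blast
  moreover have "jordan_matrix (map (\<lambda>j. (1, d (h j))) [0..<N]) = D"
  proof -
    have "jordan_matrix (map (\<lambda>j. (1, d (h j))) [0..<N]) =
          jordan_matrix (map (Pair 1) (map (d \<circ> h) [0..<N]))"
      by (simp add: comp_def)
    also have "\<dots> = D" unfolding jordan_matrix_diagonal D_def
      by (intro eq_matI) (auto simp: mat_diag_def)
    finally show ?thesis .
  qed
  ultimately have jnf: "jordan_nf A (map (\<lambda>j. (1, d (h j))) [0..<N])"
    by (auto simp: jordan_nf_def)
  have "char_poly A = (\<Prod>j = 0..<N. [:- d (h j), 1:])"
    unfolding jordan_nf_char_poly[OF jnf]
    by (simp add: comp_def prod.list_conv_set_nth)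
  then show "char_poly A = (\<Prod>x\<in>I. [:- d x, 1:])"
    using prod.reindex_bij_betw[OF h, of "\<lambda>x. [:- d x, 1:]"] by simp
  \<comment> \<open>The eigenspace is the generalized eigenspace of order 1, whose dimension counts
    the Jordan blocks for the eigenvalue.\<close>
  have "kernel_dim (char_matrix A \<mu>) = dim_gen_eigenspace A \<mu> 1"
    using A by (simp add: dim_gen_eigenspace_def)
  also have "\<dots> = length (filter (\<lambda>j. d (h j) = \<mu>) [0..<N])"
    unfolding dim_gen_eigenspace[OF jnf]
    by (simp add: filter_map comp_def sum_list_triv)
  also have "\<dots> = card {j \<in> {0..<N}. d (h j) = \<mu>}"
    by (subst distinct_length_filter) (auto intro: arg_cong[where f = card])
  also have "\<dots> = card (h ` {j \<in> {0..<N}. d (h j) = \<mu>})"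
    by (intro card_image[symmetric] inj_on_subset[OF h_inj]) auto
  also have "h ` {j \<in> {0..<N}. d (h j) = \<mu>} = {x \<in> I. d x = \<mu>}"
    using h_mem hg by (force simp: image_iff)
  finally show "kernel_dim (char_matrix A \<mu>) = card {x \<in> I. d x = \<mu>}" .
  show "\<exists>c. \<forall>i<N. v $ i = (\<Sum>x | x \<in> I \<and> d x = \<mu>. c x * e x $ i)"
    if v: "v \<in> mat_kernel (char_matrix A \<mu>)"
  proof -
    have vN: "v \<in> carrier_vec N" and v0: "char_matrix A \<mu> *\<^sub>v v = 0\<^sub>v N"
      using mat_kernelD[OF char_matrix_closed[OF A] v] by auto
    define u where "u = Q *\<^sub>v v"
    have u: "u \<in> carrier_vec N" using Q vN by (simp add: u_def)
    have "P *\<^sub>v u = v" using P Q vN by (simp add: u_def assoc_mult_mat_vec[symmetric])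
    then have vi: "v $ i = (\<Sum>x\<in>I. u $ (g x) * e x $ i)" if "i < N" for i
      using Pv[OF that u] by simp
    \<comment> \<open>The vector \<open>u\<close> holds the coordinates of \<open>v\<close> in the
      eigenbasis. Applying \<open>char_matrix A \<mu>\<close> multiplies each by
      \<open>d x - \<mu>\<close>, and the result is 0; so only coordinates with
      \<open>d x = \<mu>\<close> can survive.\<close>
    have coeff0: "(d x - \<mu>) * u $ (g x) = 0" if "x \<in> I" for x
    proof (rule eig_indep[of "\<lambda>x. (d x - \<mu>) * u $ (g x)"])
      fix i assume i: "i < N"
      have "A *\<^sub>v v = P *\<^sub>v (D *\<^sub>v u)"
        using AP A P D u \<open>P *\<^sub>v u = v\<close> by (metis assoc_mult_mat_vec)
      moreover have "(D *\<^sub>v u) $ (g x) = d x * u $ (g x)" if "x \<in> I" for x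
      proof -
        have "(D *\<^sub>v u) $ (g x) = (\<Sum>j = 0..<N. (if g x = j then d (h j) else 0) * u $ j)"
          using hg(2)[OF that] u by (simp add: D_def mat_diag_def scalar_prod_def o_def)
        also have "\<dots> = (\<Sum>j = 0..<N. if g x = j then d (h j) * u $ j else 0)"
          by (intro sum.cong) auto
        also have "\<dots> = d x * u $ (g x)"
          using hg[OF that] by simp
        finally show ?thesis .
      qed
      ultimately have "(A *\<^sub>v v) $ i = (\<Sum>x\<in>I. d x * u $ (g x) * e x $ i)"
        using Pv[OF i, of "D *\<^sub>v u"] D u by simp
      moreover have "(char_matrix A \<mu> *\<^sub>v v) $ i = (A *\<^sub>v v) $ i - \<mu> * v $ i"
        unfolding char_matrix_mult_vec[OF A vN] using A vN i by simp
      ultimately show "(\<Sum>x\<in>I. (d x - \<mu>) * u $ (g x) * e x $ i) = 0"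
        using v0 vi[OF i] i
        by (simp add: sum_distrib_left sum_subtractf left_diff_distrib mult.assoc)
    qed (use that in auto)
    have "v $ i = (\<Sum>x | x \<in> I \<and> d x = \<mu>. u $ (g x) * e x $ i)" if "i < N" for i
      unfolding vi[OF that]
    proof (rule sum.mono_neutral_right)
      show "\<forall>x\<in>I - {x. x \<in> I \<and> d x = \<mu>}. u $ (g x) * e x $ i = 0"
      proof
        fix x assume "x \<in> I - {x. x \<in> I \<and> d x = \<mu>}"
        then show "u $ (g x) * e x $ i = 0" using coeff0[of x] by simp
      qed
    qed (use I(1) in auto)
    then show ?thesis by (intro exI[of _ "\<lambda>x. u $ (g x)"]) blast
  qed
qed

section \<open>Extensions of weight functions\<close>

text \<open>
  For \<open>r = 0\<close> the condition is vacuous, so that the constant functions, which the weight functions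
  for \<open>r \<ge> 1\<close> leave out, are covered as well; they belong to the eigenvalues \<open>k + 1\<close> and \<open>- k - 1\<close>.
\<close>

definition harmonic :: "nat set \<Rightarrow> nat \<Rightarrow> (nat set \<Rightarrow> real) \<Rightarrow> bool" where
  "harmonic S r f \<longleftrightarrow>
     (\<forall>R. R \<subseteq> S \<longrightarrow> Suc (card R) = r \<longrightarrow> (\<Sum>i\<in>S - R. f (insert i R)) = 0)"

text \<open>The two conditions part at \<open>r = 0\<close>: there \<open>r - 1\<close> is again 0,
  and \<open>weight_function\<close> would constrain the singletons.\<close>

lemma weight_function_iff_harmonic:
  assumes "1 \<le> r"
  shows "weight_function k r f \<longleftrightarrow> harmonic (ground k) r f"
proof -
  have "nsets (ground k) (r - 1) = {R. R \<subseteq> ground k \<and> Suc (card R) = r}"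
    using assms by (auto simp: nsets_def ground_def intro: finite_subset)
  then show ?thesis by (auto simp: weight_function_def harmonic_def)
qed

lemma weight_ext_sum:
  "weight_ext r (\<lambda>B. \<Sum>j\<in>J. c j * w j B) A = (\<Sum>j\<in>J. c j * weight_ext r (w j) A)"
  unfolding weight_ext_def by (subst sum.swap) (simp add: sum_distrib_left)

lemma harmonic_sum:
  assumes "\<And>j. j \<in> J \<Longrightarrow> harmonic S r (w j)"
  shows "harmonic S r (\<lambda>B. \<Sum>j\<in>J. c j * w j B)"
  unfolding harmonic_def
proof (intro allI impI)
  fix R assume "R \<subseteq> S" "Suc (card R) = r"
  then have "(\<Sum>j\<in>J. c j * (\<Sum>i\<in>S - R. w j (insert i R))) = 0"
    using assms by (intro sum.neutral) (auto simp: harmonic_def)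
  then show "(\<Sum>i\<in>S - R. \<Sum>j\<in>J. c j * w j (insert i R)) = 0"
    by (subst sum.swap) (simp add: sum_distrib_left)
qed

lemma weight_ext_same_card:
  assumes "finite A" "card A = r"
  shows "weight_ext r f A = f A"
proof -
  have "nsets A r = {A}" using assms by (auto simp: nsets_def dest: card_subset_eq)
  then show ?thesis by (simp add: weight_ext_def)
qed

text \<open>The r-subsets of \<open>insert i A\<close> are split by whether they contain
  \<open>i\<close>. Writing \<open>Suc (card R) = r\<close> makes the second sum empty at
  \<open>r = 0\<close>.\<close>

lemma weight_ext_insert:
  assumes "finite A" "i \<notin> A"
  shows "weight_ext r f (insert i A) =
    weight_ext r f A + (\<Sum>R | R \<subseteq> A \<and> Suc (card R) = r. f (insert i R))"
proof -
  let ?Q = "{R. R \<subseteq> A \<and> Suc (card R) = r}"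
  have "nsets (insert i A) r = nsets A r \<union> insert i ` ?Q"
  proof
    show "nsets (insert i A) r \<subseteq> nsets A r \<union> insert i ` ?Q"
    proof
      fix B assume B: "B \<in> nsets (insert i A) r"
      show "B \<in> nsets A r \<union> insert i ` ?Q"
      proof (cases "i \<in> B")
        case True
        then have "B = insert i (B - {i})" "B - {i} \<in> ?Q"
          using B card_Suc_Diff1[of B i] by (auto simp: nsets_def)
        then show ?thesis by blast
      qed (use B in \<open>auto simp: nsets_def\<close>)
    qed
    show "nsets A r \<union> insert i ` ?Q \<subseteq> nsets (insert i A) r"
    proof -
      have "insert i R \<in> nsets (insert i A) r" if "R \<in> ?Q" for R
      proof -
        have "finite R" "i \<notin> R" using that assms finite_subset by auto
        then show ?thesis using that by (auto simp: nsets_def)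
      qed
      then show ?thesis by (auto simp: nsets_def)
    qed
  qed
  moreover have "nsets A r \<inter> insert i ` ?Q = {}" using assms by (auto simp: nsets_def)
  moreover have "inj_on (insert i) ?Q" using assms by (auto intro!: inj_onI)
  moreover have "finite ?Q" using assms by simp
  ultimately show ?thesis using assms
    by (simp add: weight_ext_def sum.union_disjoint finite_imp_finite_nsets sum.reindex)
qed

text \<open>Each \<open>i\<close> outside \<open>A\<close> contributes the extension at
  \<open>A\<close> and the values \<open>f (insert i R)\<close> with \<open>R\<close> inside
  \<open>A\<close>. The harmonic condition at \<open>R\<close> trades the sum over outer
  \<open>i\<close> for minus the sum over \<open>i\<close> in \<open>A - R\<close>, where every
  r-subset of \<open>A\<close> is met \<open>r\<close> times.\<close>

lemma sum_weight_ext_insert: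
  assumes S: "finite S" and A: "A \<subseteq> S" and f: "harmonic S r f"
  shows "(\<Sum>i\<in>S - A. weight_ext r f (insert i A)) =
    (real (card S) - real (card A) - real r) * weight_ext r f A"
proof -
  have fA: "finite A" using S A finite_subset by blast
  let ?Q = "{R. R \<subseteq> A \<and> Suc (card R) = r}"
  have "(\<Sum>i\<in>S - A. f (insert i R)) = - (\<Sum>i\<in>A - R. f (insert i R))" if "R \<in> ?Q" for R
  proof -
    have "(\<Sum>i\<in>S - R. f (insert i R)) = 0" using f that A by (auto simp: harmonic_def)
    moreover have "S - R = (S - A) \<union> (A - R)" using that A by auto
    ultimately have "(\<Sum>i\<in>(S - A) \<union> (A - R). f (insert i R)) = 0" by simp
    moreover have "(S - A) \<inter> (A - R) = {}" by auto
    ultimately show ?thesis using S fA by (simp add: sum.union_disjoint)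
  qed
  then have "(\<Sum>R\<in>?Q. \<Sum>i\<in>S - A. f (insert i R)) = - (\<Sum>R\<in>?Q. \<Sum>i\<in>A - R. f (insert i R))"
    by (simp add: sum_negf)
  also have "(\<Sum>R\<in>?Q. \<Sum>i\<in>A - R. f (insert i R)) = (\<Sum>(R, i)\<in>Sigma ?Q (\<lambda>R. A - R). f (insert i R))"
    using fA by (subst sum.Sigma) auto
  \<comment> \<open>Choosing \<open>R\<close> and a further element \<open>i\<close> amounts to
    choosing an r-subset \<open>B\<close> with a marked element.\<close>
  also have "\<dots> = (\<Sum>(B, i)\<in>Sigma (nsets A r) (\<lambda>B. B). f B)"
  proof (rule sum.reindex_bij_witness
      [where i = "\<lambda>(B, i). (B - {i}, i)" and j = "\<lambda>(R, i). (insert i R, i)"])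
    fix z assume "z \<in> Sigma ?Q (\<lambda>R. A - R)"
    then obtain R i where z: "z = (R, i)" "R \<subseteq> A" "Suc (card R) = r" "i \<in> A" "i \<notin> R" by auto
    then have "finite R" using fA finite_subset by blast
    then show "(case z of (R, i) \<Rightarrow> (insert i R, i)) \<in> Sigma (nsets A r) (\<lambda>B. B)"
      using z by (simp add: nsets_def)
    show "(case case z of (R, i) \<Rightarrow> (insert i R, i) of (B, i) \<Rightarrow> (B - {i}, i)) = z"
      using z by simp
    show "(case case z of (R, i) \<Rightarrow> (insert i R, i) of (B, i) \<Rightarrow> f B) =
          (case z of (R, i) \<Rightarrow> f (insert i R))"
      using z by simp
  next
    fix z assume "z \<in> Sigma (nsets A r) (\<lambda>B. B)"
    then obtain B i where z: "z = (B, i)" "B \<subseteq> A" "finite B" "card B = r" "i \<in> B"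
      by (auto simp: nsets_def)
    then show "(case case z of (B, i) \<Rightarrow> (B - {i}, i) of (R, i) \<Rightarrow> (insert i R, i)) = z"
      by (simp add: insert_absorb)
    show "(case z of (B, i) \<Rightarrow> (B - {i}, i)) \<in> Sigma ?Q (\<lambda>R. A - R)"
      using z card_Suc_Diff1[of B i] by auto
  qed
  also have "\<dots> = (\<Sum>B\<in>nsets A r. \<Sum>i\<in>B. f B)"
    using fA by (subst sum.Sigma) (auto simp: finite_imp_finite_nsets nsets_def)
  also have "\<dots> = real r * weight_ext r f A"
    by (simp add: weight_ext_def sum_distrib_left nsets_def)
  finally have Q: "(\<Sum>R\<in>?Q. \<Sum>i\<in>S - A. f (insert i R)) = - (real r * weight_ext r f A)" .
  have "(\<Sum>i\<in>S - A. weight_ext r f (insert i A)) =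
        (\<Sum>i\<in>S - A. weight_ext r f A + (\<Sum>R\<in>?Q. f (insert i R)))"
    using fA by (intro sum.cong) (auto simp: weight_ext_insert)
  also have "\<dots> = real (card (S - A)) * weight_ext r f A + (\<Sum>R\<in>?Q. \<Sum>i\<in>S - A. f (insert i R))"
    by (simp add: sum.distrib sum.swap[of _ "S - A"])
  also have "real (card (S - A)) = real (card S) - real (card A)"
    using S A fA by (simp add: card_Diff_subset card_mono of_nat_diff)
  finally show ?thesis unfolding Q by (simp add: algebra_simps)
qed

text \<open>An r-subset of \<open>A\<close> survives the removal of \<open>i\<close> for exactly
  \<open>card A - r\<close> elements \<open>i\<close> of \<open>A\<close>.\<close>

lemma sum_weight_ext_remove:
  assumes A: "finite A"
  shows "(\<Sum>i\<in>A. weight_ext r f (A - {i})) = (real (card A) - real r) * weight_ext r f A"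
proof -
  have fin: "finite (nsets A r)" using A by (rule finite_imp_finite_nsets)
  have "nsets (A - {i}) r = {B \<in> nsets A r. i \<notin> B}" for i by (auto simp: nsets_def)
  then have "(\<Sum>i\<in>A. weight_ext r f (A - {i})) = (\<Sum>i\<in>A. \<Sum>B | B \<in> nsets A r \<and> i \<notin> B. f B)"
    by (simp add: weight_ext_def)
  also have "\<dots> = (\<Sum>B\<in>nsets A r. \<Sum>i | i \<in> A \<and> i \<notin> B. f B)"
    using A fin by (rule sum.swap_restrict)
  also have "\<dots> = (\<Sum>B\<in>nsets A r. (real (card A) - real r) * f B)"
  proof (rule sum.cong)
    fix B assume B: "B \<in> nsets A r"
    then have "{i. i \<in> A \<and> i \<notin> B} = A - B" "card (A - B) = card A - r" "r \<le> card A"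
      using A by (auto simp: nsets_def card_Diff_subset card_mono)
    then show "(\<Sum>i | i \<in> A \<and> i \<notin> B. f B) = (real (card A) - real r) * f B"
      by (simp add: of_nat_diff)
  qed simp
  finally show ?thesis by (simp add: weight_ext_def sum_distrib_left)
qed

text \<open>Injectivity of the extension. The insertion identity carries vanishing down from level
  \<open>j + 1\<close> to level \<open>j\<close>, until level \<open>r\<close>, where the extension
  is \<open>f\<close> itself.\<close>

lemma harmonic_weight_ext_eq_0:
  assumes S: "finite S" and f: "harmonic S r f" and m: "r \<le> m" "m + r \<le> card S"
    and zero: "\<And>A. A \<in> nsets S m \<Longrightarrow> weight_ext r f A = 0"
    and B: "B \<in> nsets S r"
  shows "f B = 0"
proof -
  have vanish: "r \<le> j \<longrightarrow> (\<forall>A\<in>nsets S j. weight_ext r f A = 0)" if "j \<le> m" for j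
    using that
  proof (induction rule: inc_induct)
    case base
    show ?case by (intro impI ballI zero)
  next
    case (step j)
    show ?case
    proof (intro impI ballI)
      fix A assume "r \<le> j"
      assume "A \<in> nsets S j"
      then have A: "A \<subseteq> S" "finite A" "card A = j" by (auto simp: nsets_def)
      have "(\<Sum>i\<in>S - A. weight_ext r f (insert i A)) = 0"
        using step.IH A \<open>r \<le> j\<close> by (intro sum.neutral) (auto simp: nsets_def)
      \<comment> \<open>Since \<open>j < m\<close> and \<open>m + r \<le> card S\<close>, this
        factor is positive, so it can be cancelled.\<close>
      moreover have "real (card S) - real (card A) - real r \<noteq> 0"
        using A(3) step.hyps m(2) \<open>r \<le> j\<close> by linarith
      ultimately show "weight_ext r f A = 0"
        using sum_weight_ext_insert[OF S A(1) f] by simp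
    qed
  qed
  show ?thesis using B vanish[OF m(1)] weight_ext_same_card[of B r f] by (auto simp: nsets_def)
qed

section \<open>The adjacency operator on the two middle layers\<close>

lemma adjacency_matrix_mult_vec:
  assumes "distinct vs" "i < length vs"
  shows "(adjacency_matrix adj vs *\<^sub>v vec_of_list (map F vs)) $ i =
    (\<Sum>B | B \<in> set vs \<and> adj (vs ! i) B. F B)"
proof -
  have "(adjacency_matrix adj vs *\<^sub>v vec_of_list (map F vs)) $ i =
        (\<Sum>j = 0..<length vs. if adj (vs ! i) (vs ! j) then F (vs ! j) else 0)"
    using assms(2) by (auto simp: adjacency_matrix_def scalar_prod_def vec_of_list_index intro!: sum.cong)
  also have "\<dots> = (\<Sum>B\<in>set vs. if adj (vs ! i) B then F B else 0)"
    by (rule sum.reindex_bij_betw[OF bij_betw_nth]) (use assms in auto)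
  also have "\<dots> = (\<Sum>B | B \<in> set vs \<and> adj (vs ! i) B. F B)"
    by (simp add: sum.inter_filter)
  finally show ?thesis .
qed

text \<open>Vertices have only \<open>k\<close> or \<open>k + 1\<close> elements, so a proper
  inclusion from a k-subset goes upwards and adds a single element.\<close>

lemma middle_cube_neighbours_lower:
  assumes "A \<in> nsets (ground k) k"
  shows "{B. middle_cube_adj k A B} = (\<lambda>i. insert i A) ` (ground k - A)"
proof
  have A: "A \<subseteq> ground k" "finite A" "card A = k" using assms by (auto simp: nsets_def)
  show "{B. middle_cube_adj k A B} \<subseteq> (\<lambda>i. insert i A) ` (ground k - A)"
  proof
    fix B assume "B \<in> {B. middle_cube_adj k A B}"
    then have B: "B \<subseteq> ground k" "finite B" "card B = k \<or> card B = k + 1" "A \<subset> B \<or> B \<subset> A"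
      by (auto simp: middle_cube_adj_def middle_cube_verts_def nsets_def)
    have "\<not> B \<subset> A"
    proof
      assume "B \<subset> A"
      from psubset_card_mono[OF A(2) this] show False using A(3) B(3) by presburger
    qed
    with B(4) have "A \<subset> B" by blast
    then have "card B = k + 1" using psubset_card_mono[OF B(2) \<open>A \<subset> B\<close>] A(3) B(3) by presburger
    with \<open>A \<subset> B\<close> have "card (B - A) = 1" using A by (simp add: card_Diff_subset psubset_imp_subset)
    then obtain i where "B - A = {i}" by (auto simp: card_1_singleton_iff)
    then show "B \<in> (\<lambda>i. insert i A) ` (ground k - A)"
      using \<open>A \<subset> B\<close> B(1) by (intro image_eqI[of _ _ i]) auto
  qed
  show "(\<lambda>i. insert i A) ` (ground k - A) \<subseteq> {B. middle_cube_adj k A B}"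
    using A by (auto simp: middle_cube_adj_def middle_cube_verts_def nsets_def)
qed

lemma middle_cube_neighbours_upper:
  assumes "A \<in> nsets (ground k) (k + 1)"
  shows "{B. middle_cube_adj k A B} = (\<lambda>i. A - {i}) ` A"
proof
  have A: "A \<subseteq> ground k" "finite A" "card A = k + 1" using assms by (auto simp: nsets_def)
  show "{B. middle_cube_adj k A B} \<subseteq> (\<lambda>i. A - {i}) ` A"
  proof
    fix B assume "B \<in> {B. middle_cube_adj k A B}"
    then have B: "finite B" "card B = k \<or> card B = k + 1" "A \<subset> B \<or> B \<subset> A"
      by (auto simp: middle_cube_adj_def middle_cube_verts_def nsets_def)
    have "\<not> A \<subset> B"
    proof
      assume "A \<subset> B"
      from psubset_card_mono[OF B(1) this] show False using A(3) B(2) by presburger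
    qed
    with B(3) have "B \<subset> A" by blast
    then have "card B = k" using psubset_card_mono[OF A(2) \<open>B \<subset> A\<close>] A(3) B(2) by presburger
    with \<open>B \<subset> A\<close> have "card (A - B) = 1" using A B(1) by (simp add: card_Diff_subset psubset_imp_subset)
    then obtain i where "A - B = {i}" by (auto simp: card_1_singleton_iff)
    then show "B \<in> (\<lambda>i. A - {i}) ` A"
      using \<open>B \<subset> A\<close> by (intro image_eqI[of _ _ i]) auto
  qed
  show "(\<lambda>i. A - {i}) ` A \<subseteq> {B. middle_cube_adj k A B}"
  proof -
    have "A - {i} \<noteq> A" "A - {i} \<subset> A" "card (A - {i}) = k" if "i \<in> A" for i
      using that A by auto
    then show ?thesis
      using A by (auto simp: middle_cube_adj_def middle_cube_verts_def nsets_def)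
  qed
qed

text \<open>
  The graph is bipartite: changing the sign on the \<open>k\<close>-subsets negates the eigenvalue.
\<close>

definition eigenfun :: "nat \<Rightarrow> nat \<Rightarrow> real \<Rightarrow> (nat set \<Rightarrow> real) \<Rightarrow> nat set \<Rightarrow> real" where
  "eigenfun k r s f A = (if card A = k then s else 1) * weight_ext r f A"

text \<open>As the ground set has \<open>2 * k + 1\<close> elements, insertion into a k-subset and
  removal from a (k+1)-subset give the same factor \<open>k + 1 - r\<close>. The sign
  \<open>s\<close> sits at exactly one end of every edge.\<close>

lemma eigenfun_neighbour_sum:
  assumes f: "harmonic (ground k) r f" and s: "s * s = 1" and A: "A \<in> middle_cube_verts k"
  shows "(\<Sum>B | middle_cube_adj k A B. eigenfun k r s f B) =
    s * (real k + 1 - real r) * eigenfun k r s f A"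
proof -
  have S: "finite (ground k)" "card (ground k) = 2 * k + 1" by (auto simp: ground_def)
  consider (lower) "A \<in> nsets (ground k) k" | (upper) "A \<in> nsets (ground k) (k + 1)"
    using A by (auto simp: middle_cube_verts_def)
  then show ?thesis
  proof cases
    case lower
    then have A': "A \<subseteq> ground k" "finite A" "card A = k" by (auto simp: nsets_def)
    have "(\<Sum>B | middle_cube_adj k A B. eigenfun k r s f B) =
          (\<Sum>i\<in>ground k - A. eigenfun k r s f (insert i A))"
      unfolding middle_cube_neighbours_lower[OF lower]
      by (subst sum.reindex) (auto intro!: inj_onI)
    also have "\<dots> = (\<Sum>i\<in>ground k - A. weight_ext r f (insert i A))"
      using A' by (intro sum.cong) (auto simp: eigenfun_def)
    also have "\<dots> = (real k + 1 - real r) * weight_ext r f A"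
      using sum_weight_ext_insert[OF S(1) A'(1) f] S(2) A'(3) by simp
    \<comment> \<open>The upper neighbours carry no sign, but the value at \<open>A\<close> does: of
      the two factors \<open>s\<close>, one goes into the eigenvalue and one into
      \<open>eigenfun\<close>.\<close>
    also have "\<dots> = (s * s) * (real k + 1 - real r) * weight_ext r f A" using s by simp
    finally show ?thesis using A' by (simp add: eigenfun_def mult_ac)
  next
    case upper
    then have A': "A \<subseteq> ground k" "finite A" "card A = k + 1" by (auto simp: nsets_def)
    have "(\<Sum>B | middle_cube_adj k A B. eigenfun k r s f B) =
          (\<Sum>i\<in>A. eigenfun k r s f (A - {i}))"
      unfolding middle_cube_neighbours_upper[OF upper]
      by (subst sum.reindex) (auto intro!: inj_onI)
    also have "\<dots> = s * (\<Sum>i\<in>A. weight_ext r f (A - {i}))"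
      using A' by (auto simp: eigenfun_def sum_distrib_left intro!: sum.cong)
    also have "\<dots> = s * (real k + 1 - real r) * weight_ext r f A"
      using sum_weight_ext_remove[OF A'(2)] A'(3) by simp
    finally show ?thesis using A' by (simp add: eigenfun_def)
  qed
qed

lemma eigenfun_eigenvector:
  assumes As: "subset_orderings k As" and f: "harmonic (ground k) r f" and s: "s * s = 1"
  shows "middle_cube_matrix k As *\<^sub>v vec_of_list (map (eigenfun k r s f) (As k @ As (k + 1))) =
    (s * (real k + 1 - real r)) \<cdot>\<^sub>v vec_of_list (map (eigenfun k r s f) (As k @ As (k + 1)))"
    (is "?M *\<^sub>v ?v = ?c \<cdot>\<^sub>v ?v")
proof (rule eq_vecI)
  let ?vs = "As k @ As (k + 1)"
  have vs: "distinct ?vs" "set ?vs = middle_cube_verts k"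
    using As by (auto simp: subset_orderings_def middle_cube_verts_def nsets_def)
  show "dim_vec (?M *\<^sub>v ?v) = dim_vec (?c \<cdot>\<^sub>v ?v)"
    by (simp add: middle_cube_matrix_def adjacency_matrix_def)
  fix i assume "i < dim_vec (?c \<cdot>\<^sub>v ?v)"
  then have i: "i < length ?vs" by simp
  then have vi: "?vs ! i \<in> middle_cube_verts k" using vs(2) nth_mem by metis
  have "{B. B \<in> set ?vs \<and> middle_cube_adj k (?vs ! i) B} = {B. middle_cube_adj k (?vs ! i) B}"
    unfolding vs(2) by (auto simp: middle_cube_adj_def)
  then have "(?M *\<^sub>v ?v) $ i = (\<Sum>B | middle_cube_adj k (?vs ! i) B. eigenfun k r s f B)"
    unfolding middle_cube_matrix_def using adjacency_matrix_mult_vec[OF vs(1) i] by simp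
  also have "\<dots> = ?c * eigenfun k r s f (?vs ! i)"
    by (rule eigenfun_neighbour_sum[OF f s vi])
  also have "\<dots> = (?c \<cdot>\<^sub>v ?v) $ i"
    using i by (simp add: vec_of_list_index del: map_append)
  finally show "(?M *\<^sub>v ?v) $ i = (?c \<cdot>\<^sub>v ?v) $ i" .
qed

section \<open>Dimension count\<close>

definition harmonic_dim :: "nat \<Rightarrow> nat \<Rightarrow> nat" where
  "harmonic_dim k r = nat (binom (2 * k + 1) (int r) - binom (2 * k + 1) (int r - 1))"

lemma harmonic_dim_0: "harmonic_dim k 0 = 1"
  by (simp add: harmonic_dim_def binom_def)

text \<open>Binomial coefficients increase up to the middle, so the \<open>nat\<close> in
  \<open>harmonic_dim\<close> truncates nothing.\<close>

lemma harmonic_dim_Suc: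
  assumes "Suc r \<le> k"
  shows "harmonic_dim k (Suc r) + ((2 * k + 1) choose r) = (2 * k + 1) choose Suc r"
proof -
  have "(2 * k + 1) choose r \<le> (2 * k + 1) choose Suc r"
    using assms by (intro binomial_mono) auto
  moreover have "nat (1 + int r) = Suc r" by simp
  ultimately show ?thesis by (simp add: harmonic_dim_def binom_def)
qed

lemma int_harmonic_dim:
  assumes "r \<le> k"
  shows "int (harmonic_dim k r) = binom (2 * k + 1) (int r) - binom (2 * k + 1) (int r - 1)"
proof (cases r)
  case 0
  then show ?thesis by (simp add: harmonic_dim_0 binom_def)
next
  case (Suc q)
  then have "binom (2 * k + 1) (int r) = int ((2 * k + 1) choose Suc q)"
    "binom (2 * k + 1) (int r - 1) = int ((2 * k + 1) choose q)"
    by (auto simp: binom_def nat_add_distrib)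
  moreover have "int (harmonic_dim k r) + int ((2 * k + 1) choose q) = int ((2 * k + 1) choose Suc q)"
    using harmonic_dim_Suc[of q k] assms Suc by (metis of_nat_add)
  ultimately show ?thesis by linarith
qed

lemma sum_harmonic_dim:
  assumes "j \<le> k"
  shows "(\<Sum>r\<le>j. harmonic_dim k r) = (2 * k + 1) choose j"
  using assms
proof (induction j)
  case (Suc j)
  then show ?case using harmonic_dim_Suc[of j k] by simp
qed (simp add: harmonic_dim_0)

lemma card_nsets_ground: "card (nsets (ground k) r) = (2 * k + 1) choose r"
proof -
  have "nsets (ground k) r = {B. B \<subseteq> ground k \<and> card B = r}"
    by (auto simp: nsets_def ground_def intro: finite_subset)
  then show ?thesis using n_subsets[of "ground k" r] by (simp add: ground_def)
qed

text \<open>Brings the harmonic condition at \<open>R\<close> into the shape of a linear equation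
  over all r-subsets, with inclusion as 0/1 coefficients.\<close>

lemma sum_supersets:
  fixes f :: "'a set \<Rightarrow> 'b::semiring_1"
  assumes S: "finite S" and R: "R \<subseteq> S" "Suc (card R) = r"
  shows "(\<Sum>B\<in>nsets S r. (if R \<subseteq> B then 1 else 0) * f B) = (\<Sum>i\<in>S - R. f (insert i R))"
proof -
  have fR: "finite R" using S R(1) finite_subset by blast
  have "{B \<in> nsets S r. R \<subseteq> B} = (\<lambda>i. insert i R) ` (S - R)"
  proof
    show "{B \<in> nsets S r. R \<subseteq> B} \<subseteq> (\<lambda>i. insert i R) ` (S - R)"
    proof
      fix B assume "B \<in> {B \<in> nsets S r. R \<subseteq> B}"
      then have B: "B \<subseteq> S" "finite B" "card B = r" "R \<subseteq> B" by (auto simp: nsets_def)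
      then have "card (B - R) = 1" using fR R(2) by (simp add: card_Diff_subset)
      then obtain i where "B - R = {i}" by (auto simp: card_1_singleton_iff)
      then show "B \<in> (\<lambda>i. insert i R) ` (S - R)" using B by (intro image_eqI[of _ _ i]) auto
    qed
    show "(\<lambda>i. insert i R) ` (S - R) \<subseteq> {B \<in> nsets S r. R \<subseteq> B}"
      using fR R by (auto simp: nsets_def)
  qed
  moreover have "inj_on (\<lambda>i. insert i R) (S - R)" by (auto intro!: inj_onI)
  ultimately have "(\<Sum>B | B \<in> nsets S r \<and> R \<subseteq> B. f B) = (\<Sum>i\<in>S - R. f (insert i R))"
    by (simp add: sum.reindex)
  moreover have "(\<Sum>B\<in>nsets S r. (if R \<subseteq> B then 1 else 0) * f B) =
      (\<Sum>B | B \<in> nsets S r \<and> R \<subseteq> B. f B)"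
    using S by (subst sum.inter_filter) (auto simp: finite_imp_finite_nsets intro!: sum.cong)
  ultimately show ?thesis by simp
qed

text \<open>There is one unknown for each r-subset and one equation for each (r-1)-subset; for
  \<open>r = 0\<close> there are no equations and the single unknown is free.\<close>

lemma ex_independent_harmonics:
  assumes "r \<le> k"
  shows "\<exists>J w. J \<subseteq> nsets (ground k) r \<and> card J = harmonic_dim k r \<and>
    (\<forall>j\<in>J. harmonic (ground k) r (w j)) \<and>
    (\<forall>c. (\<forall>B\<in>nsets (ground k) r. (\<Sum>j\<in>J. c j * w j B) = 0) \<longrightarrow> (\<forall>j\<in>J. c j = 0))"
proof -
  let ?X = "{R. R \<subseteq> ground k \<and> Suc (card R) = r}"
  have S: "finite (ground k)" by (simp add: ground_def)
  have "card ?X + harmonic_dim k r = card (nsets (ground k) r)"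
  proof (cases r)
    case (Suc q)
    then have "?X = {R. R \<subseteq> ground k \<and> card R = q}" by auto
    then have "card ?X = (2 * k + 1) choose q"
      using n_subsets[OF S, of q] by (simp add: ground_def)
    then show ?thesis using harmonic_dim_Suc[of q k] assms Suc card_nsets_ground[of k r] by simp
  qed (simp add: harmonic_dim_0 card_nsets_ground)
  then have "card ?X \<le> card (nsets (ground k) r)"
    and card: "card ?X + harmonic_dim k r = card (nsets (ground k) r)" by simp_all
  moreover have "finite ?X" using S by simp
  ultimately obtain J w where J: "J \<subseteq> nsets (ground k) r"
    "card J + card ?X = card (nsets (ground k) r)"
    "\<forall>j\<in>J. \<forall>R\<in>?X. (\<Sum>B\<in>nsets (ground k) r. (if R \<subseteq> B then 1 else 0) * w j B) = (0::real)"
    "\<forall>c. (\<forall>B\<in>nsets (ground k) r. (\<Sum>j\<in>J. c j * w j B) = 0) \<longrightarrow> (\<forall>j\<in>J. c j = 0)"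
    using ex_independent_solutions[OF _ finite_imp_finite_nsets[OF S, of r],
        of ?X "\<lambda>R B. if R \<subseteq> B then 1 else 0"]
    by (elim exE conjE meta_impE) iprover+
  have "harmonic (ground k) r (w j)" if "j \<in> J" for j
    using J(3) that S by (auto simp: harmonic_def sum_supersets)
  moreover have "card J = harmonic_dim k r" using J(2) card by simp
  ultimately show ?thesis using J(1,4) by (intro exI conjI ballI)
qed

section \<open>The eigenbasis of the middle cube\<close>

theorem theorem2:
  fixes k n :: nat
    and As :: "nat \<Rightarrow> nat set list"
  assumes "n = 2 * k + 1"
    and "subset_orderings k As"
  shows "(\<forall>r::nat. 1 \<le> r \<and> r \<le> k \<longrightarrow>
            eigenspace (middle_cube_matrix k As) (real k + 1 - real r) = weight_space k As r \<and>
            int (eigenspace_dim (middle_cube_matrix k As) (real k + 1 - real r))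
              = binom n (int r) - binom n (int r - 1) \<and>
            int (eigenspace_dim (middle_cube_matrix k As) (real r - real k - 1))
              = binom n (int r) - binom n (int r - 1)) \<and>
         char_poly (middle_cube_matrix k As) =
           (\<Prod>i = 1..k + 1. ([:- real i, 1:] * [:real i, 1:]) ^
              nat (binom n (int k + 1 - int i) - binom n (int k - int i)))"
proof -
  define vs where "vs = As k @ As (k + 1)"
  define N where "N = length vs"
  define M where "M = middle_cube_matrix k As"
  have As: "distinct (As i)" "set (As i) = nsets (ground k) i" for i
    using assms(2) by (auto simp: subset_orderings_def)
  have S: "finite (ground k)" "card (ground k) = 2 * k + 1" by (auto simp: ground_def)
  have M: "M \<in> carrier_mat N N"
    by (simp add: M_def N_def vs_def middle_cube_matrix_def adjacency_matrix_def)
  have "length (As i) = (2 * k + 1) choose i" for i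
    using distinct_card[OF As(1), of i] As(2)[of i] card_nsets_ground[of k i] by simp
  moreover have "(2 * k + 1) choose (k + 1) = (2 * k + 1) choose k"
    using binomial_symmetric[of k "2 * k + 1"] by simp
  ultimately have N: "N = 2 * ((2 * k + 1) choose k)" by (simp add: N_def vs_def)
  \<comment> \<open>Index set and functions are packed into one pair so that a single choice over
    \<open>r\<close> yields both.\<close>
  have "\<forall>r. \<exists>Jw. r \<le> k \<longrightarrow> fst Jw \<subseteq> nsets (ground k) r \<and> card (fst Jw) = harmonic_dim k r \<and>
    (\<forall>j\<in>fst Jw. harmonic (ground k) r (snd Jw j)) \<and>
    (\<forall>c. (\<forall>B\<in>nsets (ground k) r. (\<Sum>j\<in>fst Jw. c j * snd Jw j B) = 0) \<longrightarrow> (\<forall>j\<in>fst Jw. c j = 0))"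
    using ex_independent_harmonics[of _ k] by (simp add: split_paired_Ex)
  from choice[OF this] obtain Jw where Jw: "\<forall>r. r \<le> k \<longrightarrow>
      fst (Jw r) \<subseteq> nsets (ground k) r \<and> card (fst (Jw r)) = harmonic_dim k r \<and>
      (\<forall>j\<in>fst (Jw r). harmonic (ground k) r (snd (Jw r) j)) \<and>
      (\<forall>c. (\<forall>B\<in>nsets (ground k) r. (\<Sum>j\<in>fst (Jw r). c j * snd (Jw r) j B) = 0)
        \<longrightarrow> (\<forall>j\<in>fst (Jw r). c j = 0))" ..
  define J where "J r = fst (Jw r)" for r
  define w where "w r = snd (Jw r)" for r
  note Jw = Jw[rule_format, folded J_def w_def]
  note J = Jw[THEN conjunct1] Jw[THEN conjunct2, THEN conjunct1]
  note w = Jw[THEN conjunct2, THEN conjunct2, THEN conjunct1]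
  note w_indep = Jw[THEN conjunct2, THEN conjunct2, THEN conjunct2]
  have finJ: "finite (J r)" if "r \<le> k" for r
    using J(1)[OF that] finite_imp_finite_nsets[OF S(1)] finite_subset by blast
  \<comment> \<open>A label consists of a level, a sign and an independent harmonic function. Level
    0 supplies the eigenvalues \<open>k + 1\<close> and \<open>- k - 1\<close>, without which the
    count would fall short of \<open>N\<close>.\<close>
  define I where "I = Sigma {..k} (\<lambda>r. {1, - 1 :: real} \<times> J r)"
  define d where "d x = (case x of (r, s, j) \<Rightarrow> s * (real k + 1 - real r))" for x :: "nat \<times> real \<times> nat set"
  define e where "e x = (case x of (r, s, j) \<Rightarrow> vec_of_list (map (eigenfun k r s (w r j)) vs))"
    for x :: "nat \<times> real \<times> nat set"
  have finI: "finite I" using finJ by (auto simp: I_def)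
  have "card I = (\<Sum>r\<le>k. card ({1, - 1 :: real} \<times> J r))"
    unfolding I_def using finJ by (intro card_SigmaI) auto
  also have "\<dots> = (\<Sum>r\<le>k. 2 * harmonic_dim k r)"
    using J(2) by (intro sum.cong) (auto simp: card_cartesian_product)
  also have "\<dots> = N" using sum_harmonic_dim[of k k] by (simp add: N sum_distrib_left[symmetric])
  finally have cardI: "card I = N" .
  have e_carrier: "e x \<in> carrier_vec N" for x
    by (cases x) (simp add: e_def N_def carrier_vecI)
  have e_nth: "e (r, s, j) $ i = eigenfun k r s (w r j) (vs ! i)" if "i < N" for r s j i
    using that by (simp add: e_def N_def vec_of_list_index)
  have eigen: "M *\<^sub>v e x = d x \<cdot>\<^sub>v e x" if x: "x \<in> I" for x
  proof -
    obtain r s j where x': "x = (r, s, j)" "r \<le> k" "s * s = 1" "j \<in> J r"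
      using x by (auto simp: I_def)
    then show ?thesis
      using eigenfun_eigenvector[OF assms(2) w[OF x'(2), rule_format, OF x'(4)] x'(3)]
      by (simp add: M_def d_def e_def vs_def)
  qed
  \<comment> \<open>Because \<open>k + 1 - r\<close> is positive for \<open>r \<le> k\<close>, an
    eigenvalue determines \<open>s\<close> by its sign and \<open>r\<close> by its absolute
    value.\<close>
  have level: "{x. x \<in> I \<and> d x = s * (real k + 1 - real r)} = (\<lambda>j. (r, s, j)) ` J r"
    if "r \<le> k" "s \<in> {1, - 1}" for r s
  proof -
    have "r' = r \<and> s' = s" if "r' \<le> k" "s' \<in> {1, - 1}"
      "s' * (real k + 1 - real r') = s * (real k + 1 - real r)" for r' s'
      using that \<open>r \<le> k\<close> \<open>s \<in> {1, - 1}\<close> by auto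
    then show ?thesis using that by (auto simp: I_def d_def)
  qed
  \<comment> \<open>By linearity a combination of eigenvectors on one level comes from a single
    harmonic function, which reduces independence to injectivity of the extension.\<close>
  have level_sum: "(\<Sum>x | x \<in> I \<and> d x = s * (real k + 1 - real r). c x * e x $ i) =
      eigenfun k r s (\<lambda>B. \<Sum>j\<in>J r. c (r, s, j) * w r j B) (vs ! i)"
    if "r \<le> k" "s \<in> {1, - 1}" "i < N" for r s c i
  proof -
    have "(\<Sum>x | x \<in> I \<and> d x = s * (real k + 1 - real r). c x * e x $ i) =
        (\<Sum>j\<in>J r. c (r, s, j) * eigenfun k r s (w r j) (vs ! i))"
      unfolding level[OF that(1,2)]
      by (subst sum.reindex) (auto simp: e_nth[OF that(3)] intro!: inj_onI)
    then show ?thesis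
      unfolding eigenfun_def weight_ext_sum sum_distrib_left by (simp only: mult.left_commute)
  qed
  have indep: "\<forall>x\<in>I. d x = \<mu> \<longrightarrow> c x = 0"
    if zero: "\<And>i. i < N \<Longrightarrow> (\<Sum>x | x \<in> I \<and> d x = \<mu>. c x * e x $ i) = 0" for \<mu> c
  proof (intro ballI impI)
    fix x assume "x \<in> I" "d x = \<mu>"
    then obtain r s j where x: "x = (r, s, j)" "r \<le> k" "s \<in> {1, - 1}" "j \<in> J r"
      and \<mu>: "\<mu> = s * (real k + 1 - real r)"
      by (auto simp: I_def d_def)
    define f where "f = (\<lambda>B. \<Sum>j\<in>J r. c (r, s, j) * w r j B)"
    have f: "harmonic (ground k) r f"
      unfolding f_def using w[OF x(2)] by (intro harmonic_sum) blast
    \<comment> \<open>The lower layer alone suffices to recover \<open>f\<close>: with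
      \<open>m = k\<close> the bound reads \<open>k + r \<le> 2 * k + 1\<close>, and the sign there
      is nonzero.\<close>
    have "weight_ext r f A = 0" if "A \<in> nsets (ground k) k" for A
    proof -
      have "A \<in> set vs" using that As(2)[of k] by (simp add: vs_def)
      then obtain i where i: "i < N" "vs ! i = A" by (auto simp: in_set_conv_nth N_def)
      have "eigenfun k r s f A = 0"
        using zero[OF i(1)] level_sum[OF x(2,3) i(1), of c] by (simp add: \<mu> f_def i(2))
      then show ?thesis using x(3) that by (auto simp: eigenfun_def nsets_def)
    qed
    then have "\<forall>B\<in>nsets (ground k) r. f B = 0"
      using harmonic_weight_ext_eq_0[OF S(1) f x(2)] x(2) S(2) by simp
    then have "\<forall>j\<in>J r. c (r, s, j) = 0"
      unfolding f_def by (rule w_indep[OF x(2), THEN spec[where x = "\<lambda>j. c (r, s, j)"], THEN mp])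
    then show "c x = 0" using x(1,4) by simp
  qed
  note basis = eigenvector_basis[OF M finI cardI e_carrier eigen indep]
  have spanning: "\<exists>c. \<forall>i<N. v $ i = (\<Sum>x | x \<in> I \<and> d x = \<mu>. c x * e x $ i)"
    if "v \<in> mat_kernel (char_matrix M \<mu>)" for v \<mu>
    by (rule eigenvector_basis(3)[OF M finI cardI e_carrier eigen indep]) (use that in simp_all)
  have dims: "kernel_dim (char_matrix M (s * (real k + 1 - real r))) = harmonic_dim k r"
    if "r \<le> k" "s \<in> {1, - 1}" for r s
  proof -
    have "card ((\<lambda>j. (r, s, j)) ` J r) = harmonic_dim k r"
      using J(2)[OF that(1)] by (subst card_image) (auto intro!: inj_onI)
    then show ?thesis using basis(2)[of "s * (real k + 1 - real r)"] level[OF that] by simp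
  qed
  have eigenspace: "eigenspace M (real k + 1 - real r) = weight_space k As r"
    if r: "1 \<le> r" "r \<le> k" for r
  proof
    show "eigenspace M (real k + 1 - real r) \<subseteq> weight_space k As r"
    proof
      fix v assume "v \<in> eigenspace M (real k + 1 - real r)"
      then have v: "v \<in> mat_kernel (char_matrix M (1 * (real k + 1 - real r)))"
        by (simp add: eigenspace_def)
      obtain c where c: "\<And>i. i < N \<Longrightarrow>
          v $ i = (\<Sum>x | x \<in> I \<and> d x = 1 * (real k + 1 - real r). c x * e x $ i)"
        using spanning[OF v] by (elim exE) simp
      \<comment> \<open>The coordinates of \<open>v\<close> in the eigenbasis assemble its weight
        function; for sign 1, \<open>eigenfun\<close> is the plain extension.\<close>
      define f where "f = (\<lambda>B. \<Sum>j\<in>J r. c (r, 1, j) * w r j B)"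
      have "harmonic (ground k) r f"
        unfolding f_def using w[OF r(2)] by (intro harmonic_sum) blast
      then have "weight_function k r f" using weight_function_iff_harmonic[OF r(1)] by blast
      moreover have "v = vec_of_list (map (weight_ext r f) vs)"
      proof (rule eq_vecI)
        show "dim_vec v = dim_vec (vec_of_list (map (weight_ext r f) vs))"
          using mat_kernelD(1)[OF char_matrix_closed[OF M] v] by (simp add: N_def)
        fix i assume "i < dim_vec (vec_of_list (map (weight_ext r f) vs))"
        then have i: "i < N" by (simp add: N_def)
        have "v $ i = eigenfun k r 1 f (vs ! i)"
          unfolding c[OF i] f_def by (rule level_sum) (use r i in auto)
        then show "v $ i = vec_of_list (map (weight_ext r f) vs) $ i"
          using i by (simp add: eigenfun_def vec_of_list_index N_def)
      qed
      ultimately show "v \<in> weight_space k As r" by (auto simp: weight_space_def vs_def)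
    qed
    show "weight_space k As r \<subseteq> eigenspace M (real k + 1 - real r)"
    proof
      fix v assume "v \<in> weight_space k As r"
      then obtain f where v: "v = vec_of_list (map (weight_ext r f) vs)" and "weight_function k r f"
        by (auto simp: weight_space_def vs_def)
      then have f: "harmonic (ground k) r f" using weight_function_iff_harmonic[OF r(1)] by blast
      have "v = vec_of_list (map (eigenfun k r 1 f) vs)"
        unfolding v by (rule arg_cong[of _ _ vec_of_list]) (simp add: eigenfun_def)
      then have "M *\<^sub>v v = (real k + 1 - real r) \<cdot>\<^sub>v v"
        using eigenfun_eigenvector[OF assms(2) f, of 1] by (simp add: M_def vs_def)
      moreover have vN: "v \<in> carrier_vec N" by (simp add: v N_def carrier_vecI)
      ultimately show "v \<in> eigenspace M (real k + 1 - real r)"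
        using mat_kernel_char_matrixI[OF M vN] by (simp add: eigenspace_def)
    qed
  qed
  have "char_poly M = (\<Prod>x\<in>I. [:- d x, 1:])" using basis(1) by blast
  also have "\<dots> = (\<Prod>r\<le>k. \<Prod>y\<in>{1, - 1} \<times> J r. [:- d (r, y), 1:])"
    unfolding I_def using finJ by (subst prod.Sigma) auto
  also have "\<dots> = (\<Prod>r\<le>k. ([:- (real k + 1 - real r), 1:] * [:real k + 1 - real r, 1:]) ^ harmonic_dim k r)"
  proof (rule prod.cong)
    fix r assume r: "r \<in> {..k}"
    then have "(\<Prod>y\<in>{1, - 1} \<times> J r. [:- d (r, y), 1:]) =
        (\<Prod>s\<in>{1, - 1}. \<Prod>j\<in>J r. [:- d (r, s, j), 1:])"
      using finJ by (subst prod.cartesian_product) (auto intro!: prod.cong)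
    also have "\<dots> = ([:- (real k + 1 - real r), 1:] * [:real k + 1 - real r, 1:]) ^ harmonic_dim k r"
      using J(2) r by (simp add: d_def power_mult_distrib del: mult_pCons_left mult_pCons_right)
    finally show "(\<Prod>y\<in>{1, - 1} \<times> J r. [:- d (r, y), 1:]) = \<dots>" .
  qed simp
  \<comment> \<open>Substituting \<open>r = k + 1 - i\<close> turns the lower indices
    \<open>r\<close> and \<open>r - 1\<close> into \<open>k + 1 - i\<close> and
    \<open>k - i\<close>; at \<open>i = k + 1\<close> the latter is -1, where \<open>binom\<close>
    is 0.\<close>
  also have "\<dots> = (\<Prod>i = 1..k + 1. ([:- real i, 1:] * [:real i, 1:]) ^
              nat (binom n (int k + 1 - int i) - binom n (int k - int i)))"
    by (rule prod.reindex_bij_witness[where i = "\<lambda>i. k + 1 - i" and j = "\<lambda>r. k + 1 - r"])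
      (auto simp: harmonic_dim_def assms(1) of_nat_diff algebra_simps)
  finally have cp: "char_poly M = \<dots>" .
  have neg: "real r - real k - 1 = - 1 * (real k + 1 - real r)" for r by simp
  show ?thesis
    unfolding M_def[symmetric] assms(1)
  proof (intro conjI allI impI)
    fix r :: nat assume r: "1 \<le> r \<and> r \<le> k"
    show "eigenspace M (real k + 1 - real r) = weight_space k As r"
      using eigenspace r by blast
    show "int (eigenspace_dim M (real k + 1 - real r)) =
        binom (2 * k + 1) (int r) - binom (2 * k + 1) (int r - 1)"
      using dims[of r 1] r int_harmonic_dim[of r k] by (simp add: eigenspace_dim_def)
    show "int (eigenspace_dim M (real r - real k - 1)) =
        binom (2 * k + 1) (int r) - binom (2 * k + 1) (int r - 1)"
      unfolding neg using dims[of r "- 1"] r int_harmonic_dim[of r k]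
      by (simp add: eigenspace_dim_def)
  qed (use cp assms(1) in simp)
qed

end
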